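(* Let $c>0$ be a constant such that $\pi(n)=\int_2^n\frac{du}{\log(u)}+O\left(\frac{n}{e^{c\sqrt{\log(n)}}}\right)$. Let $f$ be a real-valued function on $[2,\infty)$ which, for every natural $n\ge2$, is monotone and has a continuous derivative on the interval $[2,n]$. Then $$\sum_{p\le n} f(p)=\int_2^n\frac{f(t)}{\log(t)}\,dt+O\left(\frac{|f(n)|\,n}{e^{c\log^{1/2}(n)}}\right)+O\left(\int_2^n\frac{t|f'(t)|}{e^{c\log^{1/2}(t)}}\,dt\right).$$
   Context: The sum $\sum_{p\le n}$ runs over the primes $p\le n$, where $n\ge 2$ is a natural number; $\pi(n)=\sum_{p\le n}1$; $\log$ is the natural logarithm and $\log^{1/2}(t)=\sqrt{\log t}$. Each symbol $O(g(n))$ (with $g\ge 0$) denotes a quantity bounded in absolute value by $C g(n)$ for all $n\ge2$, where $C$ is a constant not depending on $n$. A constant $c>0$ with the stated property of $\pi(n)$ exists by the prime number theorem with the classical (Hadamard–de la Vallée Poussin) error term. *)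

theory Defs
  imports "HOL-Analysis.Analysis" "HOL-Library.Landau_Symbols" "HOL-Computational_Algebra.Primes"
begin

definition prime_pi :: "nat \<Rightarrow> nat" where
  "prime_pi n = (\<Sum>p | prime p \<and> p \<le> n. 1)"

text \<open>
  Landau symbols are uniform over all \<open>n \<ge> 2\<close>, not merely eventual: membership in
  \<open>O[principal {2..}](g)\<close> unfolds to a bound by a constant multiple of \<open>\<bar>g n\<bar>\<close>
  for every \<open>n \<ge> 2\<close>.
\<close>
abbreviation bigO_from2 :: "(nat \<Rightarrow> real) \<Rightarrow> (nat \<Rightarrow> real) set" where
  "bigO_from2 g \<equiv> O[principal {2..}](g)"

lemma bigO_from2_iff:
  "h \<in> bigO_from2 g \<longleftrightarrow> (\<exists>C>0. \<forall>n\<ge>2. \<bar>h n\<bar> \<le> C * \<bar>g n\<bar>)"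
  by (auto simp: bigo_def eventually_principal)

end

theory Submission
  imports Defs
begin

text \<open>
  Write \<open>Li t\<close> for the integral of \<open>1 / ln u\<close> over \<open>[2, t]\<close> and \<open>R t = \<pi>(t) - Li t\<close>. The formula is
  Riemann--Stieltjes integration of \<open>f\<close> against \<open>d\<pi> = dt / ln t + dR\<close>, in which only the part
  \<open>dR\<close> is integrated by parts:
  the sum equals the integral of \<open>f t / ln t\<close> plus \<open>R n * f n\<close> minus the integral of \<open>R t * f' t\<close>.
  The last two terms are the two error terms.

  Stieltjes integrals are avoided by carrying out two ordinary integrations by parts and
  subtracting them: Abel summation for the step function \<open>\<pi>\<close> (\<open>has_integral_counting_times_deriv\<close>),
  and the product rule for \<open>Li\<close> (\<open>has_integral_primitive_times_deriv\<close>).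

  The hypothesis bounds \<open>R\<close> at natural numbers only, whereas the integral of \<open>R t * f' t\<close> needs
  the bound at every real \<open>t \<ge> 2\<close>. Between consecutive naturals \<open>R\<close> moves by at most \<open>1 / ln 2\<close>,
  and the comparison function \<open>t / exp (c * sqrt (ln t))\<close> is bounded away from zero and
  changes by at most a constant factor, so the bound survives with a larger constant
  (\<open>prime_remainder_bound_real\<close>).
\<close>

section \<open>Two integrations by parts\<close>

text \<open>
  Abel summation. The counting function of the points \<open>x i\<close> is a sum of indicators of \<open>[x i, b]\<close>,
  and each indicator contributes \<open>f b - f (x i)\<close> by the fundamental theorem of calculus; this also
  gives the integrability of the discontinuous product.
\<close>
lemma has_integral_counting_times_deriv:
  fixes f f' :: "real \<Rightarrow> real" and x :: "'i \<Rightarrow> real"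
  assumes fin: "finite I" and x: "\<And>i. i \<in> I \<Longrightarrow> x i \<in> {a..b}"
    and deriv: "\<And>t. t \<in> {a..b} \<Longrightarrow> (f has_real_derivative f' t) (at t within {a..b})"
  shows "((\<lambda>t. real (card {i \<in> I. x i \<le> t}) * f' t) has_integral
           (real (card I) * f b - (\<Sum>i\<in>I. f (x i)))) {a..b}"
proof -
  have "((\<lambda>t. if t \<in> {x i..b} then f' t else 0) has_integral (f b - f (x i))) {a..b}"
    if i: "i \<in> I" for i
  proof -
    have sub: "{x i..b} \<subseteq> {a..b}" using x[OF i] by auto
    have "(f' has_integral (f b - f (x i))) {x i..b}"
    proof (rule fundamental_theorem_of_calculus)
      show "x i \<le> b" using x[OF i] by auto
      fix t assume "t \<in> {x i..b}"
      then have "(f has_real_derivative f' t) (at t within {x i..b})"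
        using sub by (intro DERIV_subset[OF deriv sub]) auto
      then show "(f has_vector_derivative f' t) (at t within {x i..b})"
        by (simp add: has_real_derivative_iff_has_vector_derivative)
    qed
    then show ?thesis using sub by (simp only: has_integral_restrict)
  qed
  then have sum: "((\<lambda>t. \<Sum>i\<in>I. if t \<in> {x i..b} then f' t else 0) has_integral
               (\<Sum>i\<in>I. f b - f (x i))) {a..b}"
    using fin by (intro has_integral_sum)
  have count: "(\<Sum>i\<in>I. if t \<in> {x i..b} then f' t else 0) = real (card {i \<in> I. x i \<le> t}) * f' t"
    if "t \<in> {a..b}" for t
  proof -
    have "(\<Sum>i\<in>I. if t \<in> {x i..b} then f' t else 0) = (\<Sum>i\<in>I. if x i \<le> t then f' t else 0)"
      using that by (intro sum.cong) auto
    also have "\<dots> = (\<Sum>i\<in>{i \<in> I. x i \<le> t}. f' t)"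
      using fin by (rule sum.inter_filter[symmetric])
    finally show ?thesis by simp
  qed
  from has_integral_eq[OF count sum] show ?thesis
    by (simp add: sum_subtractf)
qed

lemma has_integral_primitive_times_deriv:
  fixes f f' w :: "real \<Rightarrow> real"
  assumes ab: "a \<le> b" and w: "continuous_on {a..b} w"
    and deriv: "\<And>t. t \<in> {a..b} \<Longrightarrow> (f has_real_derivative f' t) (at t within {a..b})"
  shows "((\<lambda>t. integral {a..t} w * f' t) has_integral
           (integral {a..b} w * f b - integral {a..b} (\<lambda>t. f t * w t))) {a..b}"
proof -
  let ?W = "\<lambda>t. integral {a..t} w"
  have prod: "((\<lambda>t. ?W t * f' t + f t * w t) has_integral (?W b * f b - ?W a * f a)) {a..b}"
  proof (rule fundamental_theorem_of_calculus[OF ab])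
    fix t assume t: "t \<in> {a..b}"
    have "((\<lambda>t. ?W t * f t) has_real_derivative (?W t * f' t + f t * w t)) (at t within {a..b})"
      by (rule derivative_eq_intros integral_has_real_derivative[OF w t] deriv[OF t] | simp)+
    then show "((\<lambda>t. ?W t * f t) has_vector_derivative (?W t * f' t + f t * w t))
                 (at t within {a..b})"
      by (simp add: has_real_derivative_iff_has_vector_derivative)
  qed
  have "continuous_on {a..b} f"
    using deriv by (rule DERIV_continuous_on)
  then have "continuous_on {a..b} (\<lambda>t. f t * w t)"
    using w by (rule continuous_on_mult)
  then have "((\<lambda>t. f t * w t) has_integral integral {a..b} (\<lambda>t. f t * w t)) {a..b}"
    by (intro integrable_integral integrable_continuous_interval)
  from has_integral_diff[OF prod this] show ?thesis by simp
qed

section \<open>The remainder at real arguments\<close>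

text \<open>With \<open>s = sqrt (ln t)\<close> the left side is \<open>exp (s\<^sup>2 - c * s)\<close>; complete the square.\<close>
lemma error_scale_lower_bound:
  fixes c t :: real
  assumes "t \<ge> 1"
  shows "t / exp (c * sqrt (ln t)) \<ge> exp (- (c\<^sup>2 / 4))"
proof -
  define s where "s = sqrt (ln t)"
  have "t = exp (s\<^sup>2)" using assms by (simp add: s_def)
  moreover have "- (c\<^sup>2 / 4) \<le> s\<^sup>2 - c * s"
    using zero_le_power2[of "s - c / 2"] by (simp add: power2_eq_square algebra_simps)
  ultimately have "exp (- (c\<^sup>2 / 4)) \<le> t / exp (c * s)"
    by (simp flip: exp_diff)
  then show ?thesis by (simp only: s_def)
qed

text \<open>
  Doubling the argument raises \<open>ln\<close> by at most \<open>ln 2 < 1\<close>, hence \<open>sqrt (ln t)\<close> by at most 1.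
\<close>
lemma error_scale_doubling:
  fixes c s t :: real
  assumes c: "c \<ge> 0" and s: "1 \<le> s" "s \<le> t" "t \<le> 2 * s"
  shows "s / exp (c * sqrt (ln s)) \<le> exp c * (t / exp (c * sqrt (ln t)))"
proof -
  have "ln t \<le> ln (2 * s)" using s by simp
  also have "\<dots> \<le> ln s + 1" using s ln_2_less_1 by (simp add: ln_mult)
  finally have "sqrt (ln t) \<le> sqrt (ln s + 1)" by simp
  also have "\<dots> \<le> sqrt (ln s) + sqrt 1"
    using s by (intro sqrt_add_le_add_sqrt) auto
  finally have "c * sqrt (ln t) \<le> c * (sqrt (ln s) + 1)"
    using c by (intro mult_left_mono) auto
  then have "exp (c * sqrt (ln t)) \<le> exp c * exp (c * sqrt (ln s))"
    by (simp add: algebra_simps flip: exp_add)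
  then have "s * exp (c * sqrt (ln t)) \<le> t * (exp c * exp (c * sqrt (ln s)))"
    using s by (intro mult_mono) auto
  then show ?thesis by (simp add: field_simps)
qed

lemma continuous_on_inverse_ln: "continuous_on {2..b::real} (\<lambda>u. 1 / ln u)"
  by (intro continuous_intros) auto

lemma integral_inverse_ln_le:
  fixes s t :: real
  assumes "2 \<le> s" "s \<le> t"
  shows "\<bar>integral {s..t} (\<lambda>u. 1 / ln u)\<bar> \<le> (t - s) / ln 2"
proof -
  have "norm (integral {s..t} (\<lambda>u. 1 / ln u)) \<le> (1 / ln 2) * (t - s)"
  proof (rule integral_bound)
    show "continuous_on {s..t} (\<lambda>u. 1 / ln u)"
      using continuous_on_inverse_ln[of t] by (rule continuous_on_subset) (use assms in auto)
    fix u assume "u \<in> {s..t}"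
    then show "norm (1 / ln u) \<le> 1 / ln 2"
      using assms by (auto intro!: divide_left_mono)
  qed (use assms in auto)
  then show ?thesis by simp
qed

text \<open>
  Rounding \<open>t\<close> down to a natural number leaves \<open>\<pi>\<close> unchanged and costs at most \<open>1 / ln 2\<close> in the
  logarithmic integral.
\<close>
lemma prime_remainder_bound_real:
  fixes c C t :: real
  assumes c: "c \<ge> 0" and C: "C \<ge> 0" and t: "t \<ge> 2"
    and bound: "\<And>n. n \<ge> 2 \<Longrightarrow> \<bar>real (prime_pi n) - integral {2..real n} (\<lambda>u. 1 / ln u)\<bar>
                              \<le> C * (real n / exp (c * sqrt (ln (real n))))"
  shows "\<bar>real (prime_pi (nat \<lfloor>t\<rfloor>)) - integral {2..t} (\<lambda>u. 1 / ln u)\<bar>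
           \<le> (C * exp c + exp (c\<^sup>2 / 4) / ln 2) * (t / exp (c * sqrt (ln t)))"
proof -
  define m where "m = nat \<lfloor>t\<rfloor>"
  let ?Li = "\<lambda>t. integral {2..t} (\<lambda>u. 1 / ln u)" and ?g = "\<lambda>t. t / exp (c * sqrt (ln t))"
  have floor: "\<lfloor>t\<rfloor> \<ge> 2" using t by (simp add: le_floor_iff)
  then have m: "m \<ge> 2" "real m \<ge> 2" "real m \<le> t" "t \<le> real m + 1"
    unfolding m_def by linarith+
  have "?Li (real m) + integral {real m..t} (\<lambda>u. 1 / ln u) = ?Li t"
    using m by (intro Henstock_Kurzweil_Integration.integral_combine
        integrable_continuous_interval continuous_on_inverse_ln) auto
  then have "\<bar>real (prime_pi m) - ?Li t\<bar>
      \<le> \<bar>real (prime_pi m) - ?Li (real m)\<bar> + \<bar>integral {real m..t} (\<lambda>u. 1 / ln u)\<bar>"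
    by linarith
  also have "\<dots> \<le> C * ?g (real m) + (t - real m) / ln 2"
    using bound[OF m(1)] integral_inverse_ln_le[OF m(2,3)] by linarith
  also have "\<dots> \<le> C * (exp c * ?g t) + (exp (c\<^sup>2 / 4) / ln 2) * ?g t"
  proof (rule add_mono)
    show "C * ?g (real m) \<le> C * (exp c * ?g t)"
      using m C c by (intro mult_left_mono error_scale_doubling) auto
    have "exp (c\<^sup>2 / 4) * exp (- (c\<^sup>2 / 4)) \<le> exp (c\<^sup>2 / 4) * ?g t"
      using t by (intro mult_left_mono error_scale_lower_bound) auto
    moreover have "exp (c\<^sup>2 / 4) * exp (- (c\<^sup>2 / 4)) = 1"
      by (simp flip: exp_add)
    ultimately have "t - real m \<le> exp (c\<^sup>2 / 4) * ?g t"
      using m(4) by linarith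
    then have "(t - real m) / ln 2 \<le> exp (c\<^sup>2 / 4) * ?g t / ln 2"
      by (rule divide_right_mono) simp
    then show "(t - real m) / ln 2 \<le> (exp (c\<^sup>2 / 4) / ln 2) * ?g t" by (simp add: mult_ac)
  qed
  finally show ?thesis by (simp add: m_def algebra_simps)
qed

section \<open>Sums over primes\<close>

text \<open>Subtracting the two integrations by parts leaves the integral of \<open>R t * f' t\<close>.\<close>
lemma has_integral_prime_remainder_times_deriv:
  fixes f f' :: "real \<Rightarrow> real" and n :: nat
  assumes n: "n \<ge> 2"
    and deriv: "\<And>t. t \<in> {2..real n} \<Longrightarrow> (f has_real_derivative f' t) (at t within {2..real n})"
  shows "((\<lambda>t. (real (prime_pi (nat \<lfloor>t\<rfloor>)) - integral {2..t} (\<lambda>u. 1 / ln u)) * f' t) has_integral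
           ((real (prime_pi n) - integral {2..real n} (\<lambda>u. 1 / ln u)) * f (real n)
            + integral {2..real n} (\<lambda>t. f t / ln t)
            - (\<Sum>p | prime p \<and> p \<le> n. f (real p)))) {2..real n}"
proof -
  let ?P = "{p. prime p \<and> p \<le> n}"
  have fin: "finite ?P" by simp
  have sum: "((\<lambda>t. real (card {p \<in> ?P. real p \<le> t}) * f' t) has_integral
          (real (card ?P) * f (real n) - (\<Sum>p\<in>?P. f (real p)))) {2..real n}"
    using deriv by (intro has_integral_counting_times_deriv[OF fin]) (auto dest: prime_ge_2_nat)
  have count: "real (card {p \<in> ?P. real p \<le> t}) * f' t = real (prime_pi (nat \<lfloor>t\<rfloor>)) * f' t"
    if "t \<in> {2..real n}" for t
  proof -
    have "{p \<in> ?P. real p \<le> t} = {p. prime p \<and> p \<le> nat \<lfloor>t\<rfloor>}"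
      using that by (auto simp: le_nat_iff le_floor_iff)
    then show ?thesis by (simp add: prime_pi_def)
  qed
  have step: "((\<lambda>t. real (prime_pi (nat \<lfloor>t\<rfloor>)) * f' t) has_integral
          (real (prime_pi n) * f (real n) - (\<Sum>p\<in>?P. f (real p)))) {2..real n}"
    using has_integral_eq[OF count sum] by (simp add: prime_pi_def)
  have smooth: "((\<lambda>t. integral {2..t} (\<lambda>u. 1 / ln u) * f' t) has_integral
          (integral {2..real n} (\<lambda>u. 1 / ln u) * f (real n)
           - integral {2..real n} (\<lambda>t. f t * (1 / ln t)))) {2..real n}"
    using n deriv continuous_on_inverse_ln
    by (intro has_integral_primitive_times_deriv) auto
  from has_integral_diff[OF step smooth] show ?thesis
    by (simp add: algebra_simps)
qed

theorem mainTheorem2: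
  fixes c :: real and f f' :: "real \<Rightarrow> real"
  assumes c_pos: "c > 0"
    and pnt: "(\<lambda>n. real (prime_pi n) - integral {2..real n} (\<lambda>u. 1 / ln u))
                \<in> bigO_from2 (\<lambda>n. real n / exp (c * sqrt (ln (real n))))"
    and mono: "\<And>n::nat. n \<ge> 2 \<Longrightarrow> mono_on {2..real n} f \<or> antimono_on {2..real n} f"
    and deriv: "\<And>(n::nat) t. n \<ge> 2 \<Longrightarrow> t \<in> {2..real n} \<Longrightarrow>
                  (f has_real_derivative f' t) (at t within {2..real n})"
    and cont: "\<And>n::nat. n \<ge> 2 \<Longrightarrow> continuous_on {2..real n} f'"
  shows "\<exists>E1 \<in> bigO_from2 (\<lambda>n. \<bar>f (real n)\<bar> * real n / exp (c * sqrt (ln (real n)))).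
         \<exists>E2 \<in> bigO_from2 (\<lambda>n. integral {2..real n} (\<lambda>t. t * \<bar>f' t\<bar> / exp (c * sqrt (ln t)))).
           \<forall>n\<ge>2. (\<Sum>p | prime p \<and> p \<le> n. f (real p))
                  = integral {2..real n} (\<lambda>t. f t / ln t) + E1 n + E2 n"
proof -
  let ?g = "\<lambda>t. t / exp (c * sqrt (ln t))"
  define R where "R t = real (prime_pi (nat \<lfloor>t\<rfloor>)) - integral {2..t} (\<lambda>u. 1 / ln u)" for t :: real
  obtain C where C: "C > 0"
    and bound: "\<And>n. n \<ge> 2 \<Longrightarrow> \<bar>real (prime_pi n) - integral {2..real n} (\<lambda>u. 1 / ln u)\<bar>
                            \<le> C * (real n / exp (c * sqrt (ln (real n))))"
    using pnt by (auto simp: bigO_from2_iff)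
  define K where "K = C * exp c + exp (c\<^sup>2 / 4) / ln 2"
  have K: "K > 0" using C by (simp add: K_def add_pos_pos)
  have R_bound: "\<bar>R t\<bar> \<le> K * ?g t" if "t \<ge> 2" for t
    using prime_remainder_bound_real[OF _ _ that bound] c_pos C by (simp add: R_def K_def)
  have parts: "((\<lambda>t. R t * f' t) has_integral (R (real n) * f (real n)
      + integral {2..real n} (\<lambda>t. f t / ln t) - (\<Sum>p | prime p \<and> p \<le> n. f (real p)))) {2..real n}"
    if "n \<ge> 2" for n :: nat
    using has_integral_prime_remainder_times_deriv[OF that deriv[OF that]] by (simp add: R_def)
  define E1 where "E1 n = R (real n) * f (real n)" for n :: nat
  define E2 where "E2 n = - integral {2..real n} (\<lambda>t. R t * f' t)" for n :: nat
  have "\<bar>E1 n\<bar> \<le> K * \<bar>\<bar>f (real n)\<bar> * real n / exp (c * sqrt (ln (real n)))\<bar>" if "n \<ge> 2" for n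
  proof -
    have "\<bar>E1 n\<bar> \<le> K * ?g (real n) * \<bar>f (real n)\<bar>"
      unfolding E1_def abs_mult using that by (intro mult_right_mono R_bound) auto
    then show ?thesis by (simp add: abs_mult mult_ac)
  qed
  then have "E1 \<in> bigO_from2 (\<lambda>n. \<bar>f (real n)\<bar> * real n / exp (c * sqrt (ln (real n))))"
    using K by (auto simp: bigO_from2_iff)
  moreover have "\<bar>E2 n\<bar> \<le> K * \<bar>integral {2..real n} (\<lambda>t. t * \<bar>f' t\<bar> / exp (c * sqrt (ln t)))\<bar>"
    if n: "n \<ge> 2" for n
  proof -
    let ?h = "\<lambda>t. t * \<bar>f' t\<bar> / exp (c * sqrt (ln t))"
    have "continuous_on {2..real n} ?h"
      by (intro continuous_intros cont n) auto
    then have "?h integrable_on {2..real n}"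
      by (rule integrable_continuous_interval)
    then have int: "(\<lambda>t. K * ?h t) integrable_on {2..real n}"
      by (rule integrable_on_mult_right)
    have "norm (integral {2..real n} (\<lambda>t. R t * f' t)) \<le> integral {2..real n} (\<lambda>t. K * ?h t)"
    proof (rule integral_norm_bound_integral[OF _ int])
      show "(\<lambda>t. R t * f' t) integrable_on {2..real n}" using parts[OF n] by blast
      fix t assume "t \<in> {2..real n}"
      then have "\<bar>R t\<bar> * \<bar>f' t\<bar> \<le> K * ?g t * \<bar>f' t\<bar>"
        by (intro mult_right_mono R_bound) auto
      then show "norm (R t * f' t) \<le> K * ?h t" by (simp add: abs_mult mult_ac)
    qed
    also have "\<dots> = K * integral {2..real n} ?h"
      by (rule integral_mult_right)
    also have "\<dots> \<le> K * \<bar>integral {2..real n} ?h\<bar>"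
      using K by (intro mult_left_mono) auto
    finally show ?thesis by (simp add: E2_def)
  qed
  then have "E2 \<in> bigO_from2 (\<lambda>n. integral {2..real n} (\<lambda>t. t * \<bar>f' t\<bar> / exp (c * sqrt (ln t))))"
    using K by (auto simp: bigO_from2_iff)
  moreover have "(\<Sum>p | prime p \<and> p \<le> n. f (real p))
                  = integral {2..real n} (\<lambda>t. f t / ln t) + E1 n + E2 n" if "n \<ge> 2" for n
    using integral_unique[OF parts[OF that]] by (simp add: E1_def E2_def)
  ultimately show ?thesis by blast
qed

end
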